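(* Let $p>2$ be a prime, let $\mathcal{C}$ be a $\mathbb{Z}_p\mathbb{Z}_{p^2}$-additive code of type $(\alpha,\beta;\gamma,\delta;\kappa)$, and let $C=\Phi(\mathcal{C})$ be the corresponding $\mathbb{Z}_p\mathbb{Z}_{p^2}$-linear code. Put $L=\{1+2m \mid 1\le m\le \frac{p-1}{2}\}\cup\{p-1\}$. If $rank(C)=\gamma+2\delta+\overline{r}$ and $ker(C)=\gamma+2\delta-\overline{k}$, where $\overline{k}\in\{1,\ldots,\delta\}$, then $$1\le\overline{r}\le\sum_{l\in L}\binom{\overline{k}+l-1}{l}-\overline{k}.$$ Moreover, $\overline{r}=0$ if $\overline{k}=0$.
   Context: A $\mathbb{Z}_p\mathbb{Z}_{p^2}$-additive code is a subgroup $\mathcal{C}$ of $\mathbb{Z}_p^\alpha\times\mathbb{Z}_{p^2}^\beta$. The Gray map $\phi:\mathbb{Z}_{p^2}\to\mathbb{Z}_p^p$ is $\phi(u)=(u_1,u_1,\ldots,u_1)+u_0\,Y$, where $u=u_0+pu_1$ with $u_0,u_1\in\{0,\ldots,p-1\}$ is the $p$-ary expansion of $u$ and $Y$ is a fixed $1\times p$ row vector listing all distinct elements of $\mathbb{Z}_p$, e.g. $Y=(0,1,\ldots,p-1)$. Its extension $\Phi:\mathbb{Z}_p^\alpha\times\mathbb{Z}_{p^2}^\beta\to\mathbb{Z}_p^{n}$, $n=\alpha+p\beta$, is $\Phi(\mathbf{x},\mathbf{y})=(\mathbf{x},\phi(y_1),\ldots,\phi(y_\beta))$. A code is called $\mathbb{Z}_p\mathbb{Z}_{p^2}$-linear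 if it equals $\Phi(\mathcal{C})$ for some $\mathbb{Z}_p\mathbb{Z}_{p^2}$-additive code $\mathcal{C}$. The additive code $\mathcal{C}$ (and $C=\Phi(\mathcal{C})$) is of type $(\alpha,\beta;\gamma,\delta;\kappa)$ if $\mathcal{C}\subseteq\mathbb{Z}_p^\alpha\times\mathbb{Z}_{p^2}^\beta$, $\mathcal{C}\cong\mathbb{Z}_p^\gamma\times\mathbb{Z}_{p^2}^\delta$ as a group, and $\kappa$ is the dimension over $\mathbb{Z}_p$ of the projection onto the first $\alpha$ (i.e. the $\mathbb{Z}_p$-) coordinates of the subcode $\{\mathbf{c}\in\mathcal{C}: p\mathbf{c}=\mathbf{0}\}$ ($\kappa=0$ if $\alpha=0$). $\langle C\rangle$ is the $\mathbb{Z}_p$-linear span of $C$ in $\mathbb{Z}_p^n$, and $rank(C)=\dim\langle C\rangle$. The kernel of $C$ is $K(C)=\{\mathbf{x}\in\mathbb{Z}_p^n \mid C+\mathbf{x}=C\}$, a $\mathbb{Z}_p$-linear space, and $ker(C)=\dim K(C)$. *)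

theory Defs
  imports
    "Berlekamp_Zassenhaus.Finite_Field"
    "HOL-Library.Function_Algebras"
    "HOL-Library.Product_Plus"
    "HOL-Algebra.Group"
begin

text \<open>
  The prime \<open>p\<close> is the cardinality of a type \<open>'p :: prime_card\<close>, so that \<open>'p mod_ring\<close> is the field
  \<open>Z_p\<close>. Since the type \<open>'p \<times> 'p\<close> has exactly \<open>p * p\<close> elements, \<open>('p \<times> 'p) mod_ring\<close> is
  the ring of integers modulo \<open>p\<^sup>2\<close>; the product is used for its cardinality only.
\<close>

type_synonym 'p zp = "'p mod_ring"
type_synonym 'p zp2 = "('p \<times> 'p) mod_ring"
type_synonym 'p mixed_vec = "(nat \<Rightarrow> 'p zp) \<times> (nat \<Rightarrow> 'p zp2)"

lemma CARD_zp2: "CARD('p::prime_card zp2) = CARD('p)\<^sup>2"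
  by (simp add: power2_eq_square)

text \<open>Vectors of length \<open>n\<close> are indexed from 0 and padded with zeros beyond position \<open>n - 1\<close>.\<close>

definition vecs :: "nat \<Rightarrow> (nat \<Rightarrow> 'a::zero) set" where
  "vecs n = {v. \<forall>i\<ge>n. v i = 0}"

definition vscale :: "'a::field \<Rightarrow> (nat \<Rightarrow> 'a) \<Rightarrow> (nat \<Rightarrow> 'a)" where
  "vscale c v = (\<lambda>i. c * v i)"

lemma vector_space_vscale: "vector_space (vscale :: 'a::field \<Rightarrow> _)"
  by unfold_locales (auto simp: vscale_def fun_eq_iff algebra_simps)

definition mixed_group :: "nat \<Rightarrow> nat \<Rightarrow> 'p::prime_card mixed_vec monoid" where
  "mixed_group \<alpha> \<beta> = \<lparr>carrier = vecs \<alpha> \<times> vecs \<beta>, monoid.mult = (+), one = 0\<rparr>"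

lemma comm_group_mixed_group: "comm_group (mixed_group \<alpha> \<beta> :: 'p::prime_card mixed_vec monoid)"
proof (rule comm_groupI)
  fix x :: "'p mixed_vec"
  assume "x \<in> carrier (mixed_group \<alpha> \<beta>)"
  then show "\<exists>y\<in>carrier (mixed_group \<alpha> \<beta>). y \<otimes>\<^bsub>mixed_group \<alpha> \<beta>\<^esub> x = \<one>\<^bsub>mixed_group \<alpha> \<beta>\<^esub>"
    by (intro bexI[of _ "- x"]) (auto simp: mixed_group_def vecs_def)
qed (auto simp: mixed_group_def vecs_def add_ac zero_prod_def)

definition additive_code :: "nat \<Rightarrow> nat \<Rightarrow> 'p::prime_card mixed_vec set \<Rightarrow> bool" where
  "additive_code \<alpha> \<beta> \<C> \<longleftrightarrow> subgroup \<C> (mixed_group \<alpha> \<beta>)"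

text \<open>
  Here \<open>\<Sum>_<CARD('p). c\<close> is the multiple \<open>p c\<close>. For \<open>\<alpha> = 0\<close> the projection is \<open>{0}\<close>, whose
  dimension is 0.
\<close>

definition code_of_type ::
  "nat \<Rightarrow> nat \<Rightarrow> nat \<Rightarrow> nat \<Rightarrow> nat \<Rightarrow> 'p::prime_card mixed_vec set \<Rightarrow> bool" where
  "code_of_type \<alpha> \<beta> \<gamma> \<delta> \<kappa> \<C> \<longleftrightarrow>
     additive_code \<alpha> \<beta> \<C> \<and>
     (mixed_group \<alpha> \<beta>)\<lparr>carrier := \<C>\<rparr> \<cong> (mixed_group \<gamma> \<delta> :: 'p mixed_vec monoid) \<and>
     \<kappa> = vector_space.dim vscale (fst ` {c \<in> \<C>. (\<Sum>_<CARD('p). c) = 0})"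

text \<open>
  \<open>to_int_mod_ring u\<close> is the representative \<open>u\<^sub>0 + p u\<^sub>1\<close> of \<open>u\<close> in \<open>{0..<p\<^sup>2}\<close>; \<open>Y\<close> lists the
  elements of \<open>Z_p\<close> at positions \<open>0, \<dots>, p - 1\<close>, and \<open>t < p\<close> is the position in the image vector.
\<close>

definition gray :: "(nat \<Rightarrow> 'p::prime_card zp) \<Rightarrow> 'p zp2 \<Rightarrow> nat \<Rightarrow> 'p zp" where
  "gray Y u t =
     of_int (to_int_mod_ring u div int CARD('p)) +
     of_int (to_int_mod_ring u mod int CARD('p)) * Y t"

definition Gray ::
  "(nat \<Rightarrow> 'p::prime_card zp) \<Rightarrow> nat \<Rightarrow> nat \<Rightarrow> 'p mixed_vec \<Rightarrow> nat \<Rightarrow> 'p zp" where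
  "Gray Y \<alpha> \<beta> c i =
     (if i < \<alpha> then fst c i
      else if i < \<alpha> + CARD('p) * \<beta>
      then gray Y (snd c ((i - \<alpha>) div CARD('p))) ((i - \<alpha>) mod CARD('p))
      else 0)"

definition code_rank :: "(nat \<Rightarrow> 'a::field) set \<Rightarrow> nat" where
  "code_rank C = vector_space.dim vscale (module.span vscale C)"

definition code_kernel :: "nat \<Rightarrow> (nat \<Rightarrow> 'a::field) set \<Rightarrow> (nat \<Rightarrow> 'a) set" where
  "code_kernel n C = {x \<in> vecs n. (\<lambda>c. c + x) ` C = C}"

definition code_ker :: "nat \<Rightarrow> (nat \<Rightarrow> 'a::field) set \<Rightarrow> nat" where
  "code_ker n C = vector_space.dim vscale (code_kernel n C)"

end

theory Submission
  imports Defs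
begin

text \<open>
  Modulo \<open>p\<close>, the high digit of \<open>U = \<Sum> m\<^sub>v G\<^sub>v\<close> is \<open>w(U) - w(s)\<close>, where \<open>w(U) = (U - U\<^sup>p) / p\<close> and \<open>s\<close> is
  the low digit of \<open>U\<close>. By the binomial theorem \<open>w\<close> is additive up to degree-\<open>p\<close> monomials in the
  low digits of the \<open>G\<^sub>v\<close>, and no pure \<open>p\<close>-th powers occur. As a function of \<open>s\<close>, \<open>w(s)\<close> satisfies
  \<open>w(s) + w(-s) = s\<^sup>p\<^sup>-\<^sup>1\<close>, so that it is a polynomial in which only odd degrees below \<open>p\<close> and the
  degree \<open>p - 1\<close> occur. Hence the carries contribute to the span only monomials of degree \<open>l \<in> L\<close>
  in low-digit vectors, apart from the \<open>k\<close> pure powers; linear terms lie in the kernel already.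

  The low digit vectors of the code form a space in which those of the kernel have codimension
  \<open>k\<close>, so \<open>k\<close> generators suffice modulo the kernel, and their Gray images add \<open>k\<close> to the dimension.
  The lower bound and the case \<open>k = 0\<close> follow by comparing cardinalities, as the code has
  \<open>p\<close> to the \<open>\<gamma> + 2\<delta>\<close> elements.
\<close>

section \<open>Finite vector spaces\<close>

interpretation vs: vector_space "vscale :: 'a::field \<Rightarrow> _"
  by (rule vector_space_vscale)

lemma vscale_apply [simp]: "vscale c v i = c * v i"
  by (simp add: vscale_def)

text \<open>Adjoining \<open>b\<close> outside the span multiplies the size by that of the field,
  because \<open>scale c b + x\<close> determines \<open>c\<close> and \<open>x\<close>. Dimensions
  are later compared through cardinalities.\<close>

lemma (in vector_space) card_span_independent:
  assumes "finite (UNIV :: 'a set)" "finite B" "independent B"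
  shows "finite (span B) \<and> card (span B) = CARD('a) ^ card B"
  using assms(2,3)
proof (induction B rule: finite_induct)
  case empty
  then show ?case by simp
next
  case (insert b B)
  from insert.prems insert.hyps have b: "b \<notin> span B" and "independent B"
    by (auto simp: independent_insert)
  with insert have IH: "finite (span B)" "card (span B) = CARD('a) ^ card B"
    by auto
  let ?f = "\<lambda>(c, x). scale c b + x"
  have img: "span (insert b B) = ?f ` (UNIV \<times> span B)"
  proof (intro equalityI subsetI)
    fix x assume "x \<in> span (insert b B)"
    then obtain c where "x - scale c b \<in> span B"
      by (auto simp: span_insert)
    then show "x \<in> ?f ` (UNIV \<times> span B)"
      by (intro image_eqI[of _ _ "(c, x - scale c b)"]) auto
  next
    fix x assume "x \<in> ?f ` (UNIV \<times> span B)"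
    then show "x \<in> span (insert b B)"
      by (auto simp: insert_commute intro!: span_add span_scale intro: span_base span_mono[THEN subsetD, of B])
  qed
  have inj: "inj_on ?f (UNIV \<times> span B)"
  proof (rule inj_onI, clarify)
    fix c x d y assume xy: "x \<in> span B" "y \<in> span B" and eq: "scale c b + x = scale d b + y"
    then have "scale (c - d) b = y - x"
      by (simp add: algebra_simps)
    with xy have mem: "scale (c - d) b \<in> span B"
      by (simp add: span_diff)
    have "c = d"
    proof (rule ccontr)
      assume "c \<noteq> d"
      with span_scale[OF mem, of "inverse (c - d)"] have "b \<in> span B" by simp
      with b show False ..
    qed
    with eq show "c = d \<and> x = y" by simp
  qed
  from IH assms(1) insert.hyps show ?case
    by (simp add: img card_image[OF inj] card_cartesian_product)
qed

lemma (in vector_space) card_subspace: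
  assumes "finite (UNIV :: 'a set)" "subspace V" "finite V"
  shows "card V = CARD('a) ^ dim V"
proof -
  obtain B where B: "B \<subseteq> V" "independent B" "V \<subseteq> span B" "card B = dim V"
    by (rule basis_exists)
  moreover have "span B = V"
    using B assms(2) by (simp add: span_subspace)
  ultimately show ?thesis
    using card_span_independent[of B] assms finite_subset[of B V] by auto
qed

text \<open>All fibres over the image are translates of the zero fibre. A set closed under
  differences stands for a group here, so that codes and kernels can be inserted directly.\<close>

lemma card_additive_image:
  fixes f :: "'a::ab_group_add \<Rightarrow> 'b::ab_group_add"
  assumes "finite A" "0 \<in> A" and diff: "\<And>x y. x \<in> A \<Longrightarrow> y \<in> A \<Longrightarrow> x - y \<in> A"
    and f: "\<And>x y. x \<in> A \<Longrightarrow> y \<in> A \<Longrightarrow> f (x - y) = f x - f y"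
  shows "card A = card (f ` A) * card {a \<in> A. f a = 0}"
proof -
  have fib: "card {a \<in> A. f a = w} = card {a \<in> A. f a = 0}" if w: "w \<in> f ` A" for w
  proof -
    from w obtain b where b: "b \<in> A" "f b = w" by auto
    have plus: "x + b \<in> A" "f (x + b) = f x + w" if "x \<in> A" for x
    proof -
      have m: "0 - b \<in> A" using assms(2) b(1) by (rule diff)
      with that have "x - (0 - b) \<in> A" by (rule diff)
      then show "x + b \<in> A" by simp
      have "f 0 = 0" using f[OF assms(2,2)] by simp
      moreover have "f (x - (0 - b)) = f x - (f 0 - f b)"
        using f[OF that m] f[OF assms(2) b(1)] by simp
      ultimately show "f (x + b) = f x + w" using b by simp
    qed
    have "bij_betw (\<lambda>x. x - b) {a \<in> A. f a = w} {a \<in> A. f a = 0}"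
      by (rule bij_betwI[where g = "\<lambda>x. x + b"]) (use b diff f plus in auto)
    then show ?thesis by (rule bij_betw_same_card)
  qed
  have "card A = card (\<Union>w\<in>f ` A. {a \<in> A. f a = w})"
    by (rule arg_cong[of _ _ card]) auto
  also have "\<dots> = (\<Sum>w\<in>f ` A. card {a \<in> A. f a = w})"
    using assms(1) by (intro card_UN_disjoint) auto
  also have "\<dots> = card (f ` A) * card {a \<in> A. f a = 0}"
    by (simp add: fib)
  finally show ?thesis .
qed

lemma finite_card_vecs:
  fixes n :: nat
  shows "finite (vecs n :: (nat \<Rightarrow> 'a::{zero,finite}) set)"
    "card (vecs n :: (nat \<Rightarrow> 'a::{zero,finite}) set) = CARD('a) ^ n"
proof -
  have eq: "(vecs n :: (nat \<Rightarrow> 'a) set) = {f. \<forall>x. (x \<in> {..<n} \<longrightarrow> f x \<in> UNIV) \<and> (x \<notin> {..<n} \<longrightarrow> f x = 0)}"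
    by (auto simp: vecs_def)
  show "finite (vecs n :: (nat \<Rightarrow> 'a) set)"
    unfolding eq by (rule finite_set_of_finite_funs) auto
  \<comment> \<open>Restriction trades the padding value \<open>0\<close> for
    \<open>undefined\<close>, the default value in \<open>PiE\<close>.\<close>
  have "bij_betw (\<lambda>f. restrict f {..<n}) (vecs n :: (nat \<Rightarrow> 'a) set) (PiE {..<n} (\<lambda>_. UNIV))"
  proof (rule bij_betwI[where g = "\<lambda>f i. if i < n then f i else 0"])
    fix f :: "nat \<Rightarrow> 'a" assume "f \<in> vecs n"
    then show "(\<lambda>i. if i < n then restrict f {..<n} i else 0) = f"
      by (simp add: vecs_def fun_eq_iff)
  next
    fix f :: "nat \<Rightarrow> 'a" assume "f \<in> PiE {..<n} (\<lambda>_. UNIV)"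
    then have "restrict f {..<n} = f" by (rule PiE_restrict)
    moreover have "restrict (\<lambda>i. if i < n then f i else 0) {..<n} = restrict f {..<n}"
      by (rule restrict_ext) simp
    ultimately show "restrict (\<lambda>i. if i < n then f i else 0) {..<n} = f" by simp
  qed (simp_all add: vecs_def)
  then show "card (vecs n :: (nat \<Rightarrow> 'a) set) = CARD('a) ^ n"
    by (simp add: bij_betw_same_card card_PiE)
qed

section \<open>The carry as a polynomial\<close>

lemma mod_ring_power_card: "(x :: 'p::prime_card zp) ^ CARD('p) = x"
  using finite_field_power_card_eq_same[of x] by simp

lemma of_int_mod_ring_eq_0_iff: "(of_int n :: 'p::prime_card zp) = 0 \<longleftrightarrow> int CARD('p) dvd n"
  by (simp add: of_int_eq_0_iff_char_dvd)

text \<open>The p-derivation of the integers, reduced modulo p; the division is exact by Fermat's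
  little theorem. The argument is an integer since the value depends on it modulo
  \<open>p^2\<close>, not only modulo p.\<close>

definition witt :: "int \<Rightarrow> 'p::prime_card zp" where
  "witt U = of_int ((U - U ^ CARD('p)) div int CARD('p))"

lemma card_dvd_diff_power: "int CARD('p::prime_card) dvd U - U ^ CARD('p)"
  unfolding of_int_mod_ring_eq_0_iff[symmetric] by (simp add: mod_ring_power_card)

text \<open>By the binomial theorem the end terms are the two p-th powers, while the inner
  coefficients are divisible by p and leave products with both exponents positive.\<close>

lemma witt_add:
  "(witt (A + B) :: 'p::prime_card zp) = witt A + witt B -
     (\<Sum>i\<in>{0<..<CARD('p)}. of_nat ((CARD('p) choose i) div CARD('p)) * of_int A ^ i * of_int B ^ (CARD('p) - i))"
proof -
  let ?p = "CARD('p)"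
  let ?w = "\<lambda>U::int. (U - U ^ ?p) div int ?p"
  have p0: "?p > 0" by simp
  have w: "int ?p * ?w U = U - U ^ ?p" for U
    using card_dvd_diff_power[where 'p='p, of U] by simp
  have "(A + B) ^ ?p = (\<Sum>i\<le>?p. of_nat (?p choose i) * A ^ i * B ^ (?p - i))"
    by (rule binomial_ring)
  also have "{..?p} = insert 0 (insert ?p {0<..<?p})" by auto
  also have "(\<Sum>i\<in>insert 0 (insert ?p {0<..<?p}). of_nat (?p choose i) * A ^ i * B ^ (?p - i)) =
      B ^ ?p + A ^ ?p + (\<Sum>i\<in>{0<..<?p}. of_nat (?p choose i) * A ^ i * B ^ (?p - i))"
    using p0 by (simp add: add.assoc)
  also have "(\<Sum>i\<in>{0<..<?p}. of_nat (?p choose i) * A ^ i * B ^ (?p - i)) =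
      (\<Sum>i\<in>{0<..<?p}. int ?p * (of_nat ((?p choose i) div ?p) * A ^ i * B ^ (?p - i)))"
  proof (rule sum.cong[OF refl])
    fix i assume "i \<in> {0<..<?p}"
    then have "?p dvd (?p choose i)"
      by (intro dvd_choose_prime prime_card) auto
    then have "(of_nat (?p choose i) :: int) = int ?p * of_nat ((?p choose i) div ?p)"
      by (metis dvd_mult_div_cancel of_nat_mult)
    then show "of_nat (?p choose i) * A ^ i * B ^ (?p - i) =
        int ?p * (of_nat ((?p choose i) div ?p) * A ^ i * B ^ (?p - i))"
      by (simp add: mult.assoc)
  qed
  finally have "int ?p * ?w (A + B) = int ?p * (?w A + ?w B -
      (\<Sum>i\<in>{0<..<?p}. of_nat ((?p choose i) div ?p) * A ^ i * B ^ (?p - i)))"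
    unfolding w distrib_left right_diff_distrib by (simp add: sum_distrib_left w)
  then have "?w (A + B) = ?w A + ?w B -
      (\<Sum>i\<in>{0<..<?p}. of_nat ((?p choose i) div ?p) * A ^ i * B ^ (?p - i))"
    using p0 by (simp del: of_nat_power)
  then show ?thesis
    unfolding witt_def by simp
qed

text \<open>The product rule of a p-derivation, from
  \<open>m U - m^p U^p = m (U - U^p) + U^p (m - m^p)\<close>; modulo p the factor \<open>U^p\<close>
  becomes \<open>U\<close>.\<close>

lemma witt_mult:
  "(witt (m * U) :: 'p::prime_card zp) = of_int m * witt U + of_int U * witt m"
proof -
  let ?p = "CARD('p)"
  let ?w = "\<lambda>U::int. (U - U ^ ?p) div int ?p"
  have w: "int ?p * ?w U = U - U ^ ?p" for U
    using card_dvd_diff_power[where 'p='p, of U] by simp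
  have "int ?p * ?w (m * U) = m * (int ?p * ?w U) + U ^ ?p * (int ?p * ?w m)"
    unfolding w by (simp add: algebra_simps power_mult_distrib)
  then have "int ?p * ?w (m * U) = int ?p * (m * ?w U + U ^ ?p * ?w m)"
    by (simp only: algebra_simps)
  then have "?w (m * U) = m * ?w U + U ^ ?p * ?w m"
    by simp
  then show ?thesis
    unfolding witt_def by (simp add: mod_ring_power_card)
qed

lemma witt_uminus:
  assumes "odd CARD('p::prime_card)"
  shows "(witt (- U) :: 'p zp) = - witt U"
proof -
  have "- U - (- U) ^ CARD('p) = - (U - U ^ CARD('p))"
    using assms by simp
  then show ?thesis
    unfolding witt_def by (simp only: dvd_neg_div[OF card_dvd_diff_power] of_int_minus)
qed

text \<open>Each inner term of the sum rule contains a positive power of \<open>p D\<close>, hence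
  vanishes modulo p.\<close>

lemma witt_add_multiple:
  "(witt (U + int CARD('p) * D) :: 'p::prime_card zp) = witt U + of_int D"
proof -
  let ?p = "CARD('p)"
  have p: "?p > 1" by (rule nontriv)
  have "(of_int (int ?p * D) :: 'p zp) = 0"
    by (simp add: of_int_mod_ring_eq_0_iff)
  then have "(witt (U + int ?p * D) :: 'p zp) = witt U + witt (int ?p * D)"
    unfolding witt_add by (auto simp: power_0_left intro!: sum.neutral)
  also have "(witt (int ?p * D) :: 'p zp) = of_int D * witt (int ?p)"
    unfolding witt_mult by simp
  also have "(witt (int ?p) :: 'p zp) = 1"
  proof -
    \<comment> \<open>The quotient \<open>1 - p^(p-1)\<close> is 1 modulo p.\<close>
    have "int ?p - int ?p ^ ?p = int ?p * (1 - int ?p ^ (?p - 1))"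
      using p power_minus_mult[of ?p "int ?p"] by (simp add: algebra_simps)
    then show ?thesis
      using p unfolding witt_def by (simp add: power_0_left)
  qed
  finally show ?thesis by simp
qed

section \<open>Functions on the prime field as polynomials\<close>

lemma power_fun_apply [simp]: "(f ^ n) x = (f x :: 'a::comm_monoid_mult) ^ n"
  by (induction n) auto

lemma sum_fun_apply [simp]: "(\<Sum>a\<in>A. f a) x = (\<Sum>a\<in>A. f a x :: 'a::comm_monoid_add)"
  by (induction A rule: infinite_finite_induct) auto

lemma mod_ring_power_card_minus_1: "x \<noteq> 0 \<Longrightarrow> (x :: 'p::prime_card zp) ^ (CARD('p) - 1) = 1"
  using mod_ring_power_card[of x] power_minus_mult[of "CARD('p)" x] by simp

text \<open>Interpolation: by Fermat's little theorem, \<open>1 - (X - a)^(p-1)\<close> is the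
  indicator function of \<open>a\<close>.\<close>

lemma mod_ring_function_polynomial:
  fixes g :: "'p::prime_card zp \<Rightarrow> 'p zp"
  obtains c where "\<And>s. g s = (\<Sum>i<CARD('p). c i * s ^ i)"
proof -
  let ?p = "CARD('p)"
  have p: "?p > 1" by (rule nontriv)
  define P where "P = (\<Sum>a\<in>UNIV. smult (g a) (1 - [:- a, 1:] ^ (?p - 1)))"
  have "degree P \<le> ?p - 1"
    unfolding P_def
    by (intro degree_sum_le order.trans[OF degree_smult_le] degree_diff_le order.trans[OF degree_power_le]) auto
  then have "poly P s = (\<Sum>i<?p. coeff P i * s ^ i)" for s
    unfolding poly_altdef using p
    by (intro sum.mono_neutral_left) (auto simp: coeff_eq_0)
  moreover have "poly P s = g s" for s
  proof -
    have "poly P s = (\<Sum>a\<in>UNIV. if a = s then g a else 0)"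
      unfolding P_def poly_sum using p mod_ring_power_card_minus_1[where 'p='p]
      by (intro sum.cong) (auto simp: power_0_left)
    then show ?thesis by simp
  qed
  ultimately show ?thesis using that by metis
qed

lemma to_int_of_int_mod_ring: "to_int_mod_ring (of_int U :: 'p::prime_card zp) = U mod int CARD('p)"
  unfolding of_int_of_int_mod_ring by transfer simp

lemma of_int_to_int_mod_ring [simp]: "of_int (to_int_mod_ring x) = (x :: 'a::nontriv mod_ring)"
  by (simp add: of_int_of_int_mod_ring)

text \<open>Splitting \<open>U\<close> into its residue and p times its quotient expresses floor
  division, the source of carries, by values of \<open>witt\<close>.\<close>

lemma of_int_div_card:
  "(of_int (U div int CARD('p)) :: 'p::prime_card zp) =
     witt U - witt (to_int_mod_ring (of_int U :: 'p zp))"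
  using witt_add_multiple[where 'p='p, of "U mod int CARD('p)" "U div int CARD('p)"]
  by (simp add: to_int_of_int_mod_ring)

lemma witt_0 [simp]: "witt 0 = 0"
  using witt_mult[of 0 0] by simp

lemma half_sum_diff:
  fixes a b t :: "'a::field"
  assumes "2 \<noteq> (0 :: 'a)" "a - b = 2 * t"
  shows "a = t + inverse 2 * (a + b)"
proof -
  have "a = inverse 2 * (a + a)"
    using assms(1) by (simp add: mult_2[symmetric])
  also have "a + a = 2 * t + (a + b)"
    unfolding assms(2)[symmetric] by simp
  finally show ?thesis
    using assms(1) by (simp add: distrib_left)
qed

text \<open>The even part of the interpolation polynomial is replaced by an explicit one: for
  nonzero \<open>s\<close> the representatives of \<open>s\<close> and \<open>- s\<close> add up to
  p, so the two values of \<open>witt\<close> add up to 1, which is \<open>s^(p-1)\<close>.\<close>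

lemma witt_representative_polynomial:
  assumes "odd CARD('p::prime_card)"
  obtains c :: "nat \<Rightarrow> 'p::prime_card zp" and d where
    "\<And>s :: 'p::prime_card zp. witt (to_int_mod_ring s) =
       (\<Sum>i | odd i \<and> i < CARD('p). c i * s ^ i) + d * s ^ (CARD('p) - 1)"
proof -
  let ?p = "CARD('p)"
  define g :: "'p zp \<Rightarrow> 'p zp" where "g s = witt (to_int_mod_ring s)" for s
  have p: "?p > 2"
    using assms nontriv[where 'a='p] by (cases "?p = 2") auto
  have two: "(2 :: 'p zp) \<noteq> 0"
    using of_nat_0_mod_ring_dvd[where 'a='p, of 2] p by (auto dest!: dvd_imp_le)
  obtain c where c: "\<And>s. g s = (\<Sum>i<?p. c i * s ^ i)"
    using mod_ring_function_polynomial[of g] by blast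
  have w0: "witt 0 = (0 :: 'p zp)"
    by (rule witt_0)
  have reflect: "g s + g (- s) = s ^ (?p - 1)" for s
  proof (cases "s = 0")
    case True
    then show ?thesis using p w0 by (simp add: g_def power_0_left)
  next
    case False
    have "to_int_mod_ring s \<in> range (to_int_mod_ring :: 'p zp \<Rightarrow> int)" by simp
    then have "0 \<le> to_int_mod_ring s" "to_int_mod_ring s < int ?p"
      unfolding range_to_int_mod_ring by auto
    moreover have "to_int_mod_ring s \<noteq> 0" using False by simp
    \<comment> \<open>The factor 1 is the \<open>D\<close> of \<open>witt_add_multiple\<close>,
      applied below.\<close>
    ultimately have "(int ?p * 1 - to_int_mod_ring s) mod int ?p = int ?p * 1 - to_int_mod_ring s"
      by (intro mod_pos_pos_trivial) linarith+
    moreover have "- s = of_int (int ?p * 1 - to_int_mod_ring s)" by simp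
    ultimately have "to_int_mod_ring (- s) = int ?p * 1 - to_int_mod_ring s"
      by (simp only: to_int_of_int_mod_ring)
    then have "g (- s) = witt (- to_int_mod_ring s + int ?p * 1)"
      by (simp add: g_def)
    also have "\<dots> = - g s + 1"
      unfolding witt_add_multiple witt_uminus[OF assms] g_def by simp
    finally show ?thesis
      using mod_ring_power_card_minus_1[OF False] by simp
  qed
  have "g s = (\<Sum>i | odd i \<and> i < ?p. c i * s ^ i) + inverse 2 * s ^ (?p - 1)" for s
  proof -
    \<comment> \<open>Even powers cancel in this difference and odd ones double.\<close>
    have "g s - g (- s) = (\<Sum>i<?p. c i * s ^ i - c i * (- s) ^ i)"
      by (simp add: c sum_subtractf)
    also have "\<dots> = (\<Sum>i\<in>{i. odd i \<and> i < ?p}. c i * s ^ i - c i * (- s) ^ i)"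
      by (intro sum.mono_neutral_right) auto
    also have "\<dots> = 2 * (\<Sum>i | odd i \<and> i < ?p. c i * s ^ i)"
      by (simp add: sum_distrib_left)
    finally show ?thesis
      using half_sum_diff[OF two, of "g s" "g (- s)"] by (simp only: reflect)
  qed
  then show ?thesis unfolding g_def by (rule that)
qed

section \<open>Monomials in spanning vectors, with pointwise multiplication\<close>

lemma span_times:
  fixes x y :: "nat \<Rightarrow> 'a::field"
  assumes "x \<in> vs.span A" "y \<in> vs.span B"
    and AB: "\<And>a b. a \<in> A \<Longrightarrow> b \<in> B \<Longrightarrow> a * b \<in> vs.span C"
  shows "x * y \<in> vs.span C"
proof -
  have scale: "vscale c u * v = vscale c (u * v)" "u * vscale c v = vscale c (u * v)"
    for c and u v :: "nat \<Rightarrow> 'a"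
    by (auto simp: fun_eq_iff)
  have 1: "a * y \<in> vs.span C" if a: "a \<in> A" for a
    using assms(2)
  proof (induction rule: vs.span_induct_alt)
    case base
    show ?case by (simp only: mult_zero_right vs.span_zero)
  next
    case (step c b z)
    show ?case
      unfolding distrib_left scale by (rule vs.span_add[OF vs.span_scale[OF AB[OF a step(1)]] step(2)])
  qed
  from assms(1) show ?thesis
  proof (induction rule: vs.span_induct_alt)
    case base
    show ?case by (simp only: mult_zero_left vs.span_zero)
  next
    case (step c a z)
    show ?case
      unfolding distrib_right scale by (rule vs.span_add[OF vs.span_scale[OF 1[OF step(1)]] step(2)])
  qed
qed

text \<open>Expanding the power gives products of \<open>l\<close> generators. Indexing them by
  multisets identifies reorderings and prepares the counting.\<close>

lemma span_power:
  fixes x :: "nat \<Rightarrow> 'a::field"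
  assumes "x \<in> vs.span S"
  shows "x ^ l \<in> vs.span (prod_mset ` multisets_of_size S l)"
proof (induction l)
  case 0
  show ?case by (rule vs.span_base) simp
next
  case (Suc l)
  have step: "a * prod_mset M \<in> prod_mset ` multisets_of_size S (Suc l)"
    if "a \<in> S" "M \<in> multisets_of_size S l" for a M
    using that by (intro image_eqI[of _ _ "add_mset a M"]) (auto simp: multisets_of_size_def)
  show ?case
    unfolding power_Suc by (rule span_times[OF assms Suc]) (auto intro!: vs.span_base step)
qed

text \<open>The multisets \<open>replicate_mset n v\<close> are left out because they stand for the pure powers.\<close>

definition mixed_monomials :: "nat \<Rightarrow> (nat \<Rightarrow> 'a::field) set \<Rightarrow> (nat \<Rightarrow> 'a) set" where
  "mixed_monomials n S = prod_mset ` (multisets_of_size S n - replicate_mset n ` S)"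

text \<open>As \<open>b\<close> is not in \<open>A\<close>, it occurs exactly \<open>n - j\<close>
  times in each product. This lies strictly between 0 and \<open>n\<close>, so no pure power
  arises.\<close>

lemma span_mixed_monomials:
  fixes x b :: "nat \<Rightarrow> 'a::field"
  assumes x: "x \<in> vs.span A" and A: "A \<subseteq> S" and b: "b \<in> S - A" and j: "0 < j" "j < n"
  shows "x ^ j * (vscale c b) ^ (n - j) \<in> vs.span (mixed_monomials n S)"
proof (rule span_times[OF span_power[OF x]])
  have "(vscale c b) ^ (n - j) = vscale (c ^ (n - j)) (b ^ (n - j))"
    by (auto simp: fun_eq_iff power_mult_distrib)
  then show "(vscale c b) ^ (n - j) \<in> vs.span {b ^ (n - j)}"
    by (auto intro: vs.span_scale vs.span_base)
next
  fix u v assume "u \<in> prod_mset ` multisets_of_size A j" "v \<in> {b ^ (n - j)}"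
  then obtain M where M: "set_mset M \<subseteq> A" "size M = j" "u = prod_mset M" and v: "v = b ^ (n - j)"
    by (auto simp: multisets_of_size_def)
  let ?N = "M + replicate_mset (n - j) b"
  have "count M b = 0" using M b by (auto simp: count_eq_zero_iff)
  then have count: "count ?N b = n - j" by simp
  have "?N \<notin> replicate_mset n ` S"
  proof
    assume "?N \<in> replicate_mset n ` S"
    then obtain v where "?N = replicate_mset n v" by auto
    with count have "(if b = v then n else 0) = n - j" by (metis count_replicate_mset)
    with j show False by (auto split: if_splits)
  qed
  moreover have "?N \<in> multisets_of_size S n"
    using M A b j by (auto simp: multisets_of_size_def split: if_splits)
  moreover have "prod_mset ?N = u * v"
    using M v by simp
  ultimately have "u * v \<in> mixed_monomials n S"
    unfolding mixed_monomials_def by (metis DiffI imageI)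
  then show "u * v \<in> vs.span (mixed_monomials n S)"
    by (rule vs.span_base)
qed

text \<open>Induction over \<open>A\<close>: the product rule leaves a multiple of the new vector
  \<open>b\<close>, and the sum rule leaves positive powers of the partial sum times positive powers
  of \<open>b\<close>, which are mixed because \<open>b\<close> is new.\<close>

lemma span_witt_sum:
  fixes S :: "(nat \<Rightarrow> 'p::prime_card zp) set"
  assumes "finite A" "A \<subseteq> S" and G: "\<And>v i. v \<in> A \<Longrightarrow> of_int (G v i) = v i"
  shows "(\<lambda>i. witt (\<Sum>v\<in>A. m v * G v i)) -
      (\<Sum>v\<in>A. vscale (of_int (m v)) (\<lambda>i. witt (G v i))) \<in> vs.span (S \<union> mixed_monomials CARD('p) S)"
    (is "?W A - ?w A \<in> vs.span ?Z")
  using assms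
proof (induction A rule: finite_induct)
  case empty
  have "(\<lambda>i::nat. witt 0) = (0 :: nat \<Rightarrow> 'p zp)"
    by (simp add: fun_eq_iff)
  then show ?case by (simp only: sum.empty diff_self vs.span_zero)
next
  case (insert b A)
  let ?p = "CARD('p)"
  let ?x = "\<Sum>v\<in>A. vscale (of_int (m v)) v"
  let ?c = "\<lambda>j. of_nat ((?p choose j) div ?p) :: 'p zp"
  \<comment> \<open>The correction in \<open>witt_add\<close>, with \<open>?x\<close> the residue of
    the partial sum.\<close>
  let ?R = "\<Sum>j\<in>{0<..<?p}. vscale (?c j) (?x ^ j * vscale (of_int (m b)) b ^ (?p - j))"
  have bS: "b \<in> S" and AS: "A \<subseteq> S" and G: "\<And>v i. v \<in> insert b A \<Longrightarrow> of_int (G v i) = v i"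
    using insert.prems by auto
  have IH: "?W A - ?w A \<in> vs.span ?Z"
    by (rule insert.IH) (use AS G in auto)
  have x: "?x \<in> vs.span A"
    by (intro vs.span_sum vs.span_scale vs.span_base)
  have "?R \<in> vs.span (mixed_monomials ?p S)"
    by (intro vs.span_sum vs.span_scale span_mixed_monomials[OF x AS]) (use bS insert.hyps in auto)
  then have R: "?R \<in> vs.span ?Z"
    using vs.span_mono[of "mixed_monomials ?p S" ?Z] by auto
  have b: "vscale (witt (m b)) b \<in> vs.span ?Z"
    using bS by (intro vs.span_scale vs.span_base) auto
  have X: "(of_int (\<Sum>v\<in>A. m v * G v i) :: 'p zp) = ?x i" for i
    by (simp add: G)
  have "?W (insert b A) - ?w (insert b A) = (?W A - ?w A) + vscale (witt (m b)) b - ?R"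
  proof
    fix i
    have "?W (insert b A) i = witt ((\<Sum>v\<in>A. m v * G v i) + m b * G b i)"
      using insert.hyps by (simp add: add.commute)
    also have "\<dots> = ?W A i + (of_int (m b) * witt (G b i) + b i * witt (m b)) - ?R i"
      unfolding witt_add witt_mult X
      by (simp add: mult.assoc G)
    finally show "(?W (insert b A) - ?w (insert b A)) i = ((?W A - ?w A) + vscale (witt (m b)) b - ?R) i"
      using insert.hyps by (simp add: mult.commute)
  qed
  then show ?case
    by (simp only:) (rule vs.span_diff[OF vs.span_add[OF IH b] R])
qed

section \<open>Degrees and number of the carry monomials\<close>

definition gray_degrees :: "nat \<Rightarrow> nat set" where
  "gray_degrees p = {1 + 2 * m | m. 1 \<le> m \<and> m \<le> (p - 1) div 2} \<union> {p - 1}"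

definition carry_monomials :: "nat \<Rightarrow> (nat \<Rightarrow> 'a::field) set \<Rightarrow> (nat \<Rightarrow> 'a) set" where
  "carry_monomials p S = mixed_monomials p S \<union>
     (\<Union>l\<in>gray_degrees p - {p}. prod_mset ` multisets_of_size S l)"

lemma finite_gray_degrees [simp]: "finite (gray_degrees p)"
proof -
  have "{1 + 2 * m | m. 1 \<le> m \<and> m \<le> (p - 1) div 2} = (\<lambda>m. 1 + 2 * m) ` {1..(p - 1) div 2}"
    by auto
  then show ?thesis by (simp add: gray_degrees_def)
qed

lemma mem_gray_degrees_odd: "odd i \<Longrightarrow> 3 \<le> i \<Longrightarrow> i \<le> p \<Longrightarrow> i \<in> gray_degrees p"
  unfolding gray_degrees_def by (auto elim!: oddE)

lemma finite_carry_monomials: "finite S \<Longrightarrow> finite (carry_monomials p S)"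
  by (auto simp: carry_monomials_def mixed_monomials_def finite_multisets_of_size)

text \<open>Stars and bars counts all multisets, of which \<open>card S\<close> are pure. Different
  multisets may have equal products, whence an inequality.\<close>

lemma card_mixed_monomials:
  assumes "finite S" "n > 0"
  shows "card (mixed_monomials n S) + card S \<le> (card S + n - 1) choose n"
proof -
  have sub: "replicate_mset n ` S \<subseteq> multisets_of_size S n"
    using assms(2) by (auto simp: multisets_of_size_def split: if_splits)
  have "inj_on (replicate_mset n) S"
    using assms(2) by (auto simp: inj_on_def replicate_mset_eq_iff)
  then have "card (replicate_mset n ` S) = card S"
    by (rule card_image)
  moreover have "card (mixed_monomials n S) \<le> card (multisets_of_size S n - replicate_mset n ` S)"
    unfolding mixed_monomials_def using assms
    by (intro card_image_le) (simp add: finite_multisets_of_size)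
  moreover have "card (multisets_of_size S n - replicate_mset n ` S) + card (replicate_mset n ` S) =
      card (multisets_of_size S n)"
    using card_Diff_subset[OF finite_subset[OF sub] sub] card_mono[OF _ sub] assms
    by (simp add: finite_multisets_of_size)
  ultimately show ?thesis
    using assms by (simp add: card_multisets_of_size)
qed

text \<open>A union bound over the degrees; the pure powers missing in degree p make room for
  \<open>card S\<close> on the left.\<close>

lemma card_carry_monomials:
  assumes "finite S" "odd p" "p > 2"
  shows "card (carry_monomials p S) + card S \<le> (\<Sum>l\<in>gray_degrees p. (card S + l - 1) choose l)"
proof -
  let ?M = "\<lambda>l. prod_mset ` multisets_of_size S l"
  have p: "p \<in> gray_degrees p"
    using assms by (intro mem_gray_degrees_odd) auto
  have "card (\<Union>l\<in>gray_degrees p - {p}. ?M l) \<le> (\<Sum>l\<in>gray_degrees p - {p}. card (?M l))"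
    by (intro card_UN_le) simp
  also have "\<dots> \<le> (\<Sum>l\<in>gray_degrees p - {p}. (card S + l - 1) choose l)"
    using assms
    by (intro sum_mono order.trans[OF card_image_le])
      (auto simp: card_multisets_of_size finite_multisets_of_size)
  finally have "card (carry_monomials p S) \<le>
      card (mixed_monomials p S) + (\<Sum>l\<in>gray_degrees p - {p}. (card S + l - 1) choose l)"
    unfolding carry_monomials_def by (intro order.trans[OF card_Un_le] add_left_mono)
  moreover have "card (mixed_monomials p S) + card S \<le> (card S + p - 1) choose p"
    using assms by (intro card_mixed_monomials) auto
  ultimately show ?thesis
    using p by (simp add: sum.remove[of "gray_degrees p" p])
qed

text \<open>In the polynomial for \<open>witt\<close> on representatives, degree 1 stays in the span
  of \<open>S\<close>; the other degrees are \<open>p - 1\<close> or odd and at least 3, all below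
  p.\<close>

lemma span_witt_digit:
  fixes y :: "nat \<Rightarrow> 'p::prime_card zp"
  assumes p: "odd CARD('p)" "CARD('p) > 2" and y: "y \<in> vs.span S"
  shows "(\<lambda>i. witt (to_int_mod_ring (y i))) \<in> vs.span (S \<union> carry_monomials CARD('p) S)"
proof -
  let ?p = "CARD('p)" and ?Z = "S \<union> carry_monomials CARD('p) S"
  obtain c :: "nat \<Rightarrow> 'p zp" and d where
    c: "\<And>s. witt (to_int_mod_ring s) = (\<Sum>i | odd i \<and> i < ?p. c i * s ^ i) + d * s ^ (?p - 1)"
    using witt_representative_polynomial[OF p(1)] by blast
  have pow: "y ^ l \<in> vs.span ?Z" if l: "l \<in> gray_degrees ?p - {?p}" for l
  proof -
    have "prod_mset ` multisets_of_size S l \<subseteq> ?Z"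
      using l by (auto simp: carry_monomials_def)
    then show ?thesis
      using span_power[OF y] vs.span_mono by blast
  qed
  have odd: "y ^ i \<in> vs.span ?Z" if i: "odd i" "i < ?p" for i
  proof (cases "i = 1")
    case True
    then show ?thesis using y vs.span_mono[of S ?Z] by auto
  next
    case False
    with i have "3 \<le> i" by (auto elim!: oddE)
    with i show ?thesis by (intro pow) (auto intro: mem_gray_degrees_odd)
  qed
  have even: "y ^ (?p - 1) \<in> vs.span ?Z"
    using p by (intro pow) (auto simp: gray_degrees_def)
  have "(\<lambda>i. witt (to_int_mod_ring (y i))) =
      (\<Sum>i | odd i \<and> i < ?p. vscale (c i) (y ^ i)) + vscale d (y ^ (?p - 1))"
    by (auto simp: fun_eq_iff c)
  also have "\<dots> \<in> vs.span ?Z"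
    using odd even by (intro vs.span_add vs.span_sum vs.span_scale) auto
  finally show ?thesis .
qed

text \<open>Floor division is rewritten as \<open>witt\<close> of the integer minus
  \<open>witt\<close> of its residue, for the whole sum and for each \<open>G v\<close>. The
  resulting pieces are covered by \<open>span_witt_sum\<close> and
  \<open>span_witt_digit\<close>.\<close>

lemma span_div_sum:
  fixes S :: "(nat \<Rightarrow> 'p::prime_card zp) set"
  assumes p: "odd CARD('p)" "CARD('p) > 2"
    and "finite S" and G: "\<And>v i. v \<in> S \<Longrightarrow> of_int (G v i) = v i"
  shows "(\<lambda>i. of_int ((\<Sum>v\<in>S. m v * G v i) div int CARD('p))) -
      (\<Sum>v\<in>S. vscale (of_int (m v)) (\<lambda>i. of_int (G v i div int CARD('p))))
    \<in> vs.span (S \<union> carry_monomials CARD('p) S)" (is "?lhs \<in> vs.span ?Z")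
proof -
  define y where "y = (\<Sum>v\<in>S. vscale (of_int (m v)) v)"
  define q :: "(nat \<Rightarrow> 'p zp) \<Rightarrow> nat \<Rightarrow> 'p zp" where "q x = (\<lambda>i. witt (to_int_mod_ring (x i)))" for x
  define w where "w = (\<lambda>i. witt (\<Sum>v\<in>S. m v * G v i)) -
      (\<Sum>v\<in>S. vscale (of_int (m v)) (\<lambda>i. witt (G v i) :: 'p zp))"
  have w: "w \<in> vs.span ?Z"
  proof -
    have "w \<in> vs.span (S \<union> mixed_monomials CARD('p) S)"
      unfolding w_def by (rule span_witt_sum) (use assms(3) G in auto)
    then show ?thesis
      using vs.span_mono[of "S \<union> mixed_monomials CARD('p) S" ?Z]
      by (auto simp: carry_monomials_def)
  qed
  have q: "q x \<in> vs.span ?Z" if "x \<in> vs.span S" for x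
    unfolding q_def by (rule span_witt_digit[OF p that])
  have y: "y \<in> vs.span S"
    unfolding y_def by (intro vs.span_sum vs.span_scale vs.span_base)
  have qS: "(\<Sum>v\<in>S. vscale (of_int (m v)) (q v)) \<in> vs.span ?Z"
    by (intro vs.span_sum vs.span_scale q vs.span_base)
  have yi: "of_int (\<Sum>v\<in>S. m v * G v i) = y i" for i
    by (simp add: y_def G)
  have "?lhs = w - q y + (\<Sum>v\<in>S. vscale (of_int (m v)) (q v))"
  proof
    fix i
    show "?lhs i = (w - q y + (\<Sum>v\<in>S. vscale (of_int (m v)) (q v))) i"
      unfolding of_int_div_card w_def q_def yi
      by (simp add: G right_diff_distrib sum_subtractf)
  qed
  then show ?thesis
    by (simp only:) (rule vs.span_add[OF vs.span_diff[OF w q[OF y]] qS])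
qed

section \<open>Digits and the Gray map\<close>

text \<open>Needed for the ring \<open>'p zp2\<close> to have a unit.\<close>

instance prod :: (nontriv, nontriv) nontriv
proof
  have "1 < CARD('a)" "1 < CARD('b)" by (rule nontriv)+
  then show "1 < CARD('a \<times> 'b)" by (simp only: card_prod less_1_mult)
qed

text \<open>Reduction modulo p, a ring homomorphism.\<close>

definition digit :: "'p::prime_card zp2 \<Rightarrow> 'p zp" where
  "digit u = of_int (to_int_mod_ring u)"

lemma digit_of_int: "digit (of_int U :: 'p::prime_card zp2) = of_int U"
proof -
  have "to_int_mod_ring (of_int U :: 'p zp2) = U mod int (CARD('p) * CARD('p))"
    unfolding of_int_of_int_mod_ring by transfer simp
  then have "U - to_int_mod_ring (of_int U :: 'p zp2) = int CARD('p) * (int CARD('p) * (U div int (CARD('p) * CARD('p))))"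
    by (simp add: minus_mod_eq_mult_div mult.assoc)
  then have "(of_int (U - to_int_mod_ring (of_int U :: 'p zp2)) :: 'p zp) = 0"
    unfolding of_int_mod_ring_eq_0_iff by simp
  then show ?thesis by (simp add: digit_def)
qed

lemma digit_add: "digit (u + v) = digit u + digit v" for u v :: "'p::prime_card zp2"
  using digit_of_int[where 'p='p, of "to_int_mod_ring u + to_int_mod_ring v"] by (simp add: digit_def)

lemma digit_diff: "digit (u - v) = digit u - digit v" for u v :: "'p::prime_card zp2"
  using digit_add[of "u - v" v] by simp

lemma digit_of_nat_mult: "digit (of_nat n * u) = of_nat n * digit u" for u :: "'p::prime_card zp2"
  using digit_of_int[where 'p='p, of "int n * to_int_mod_ring u"] by (simp add: digit_def)

text \<open>Any integer representative serves: a multiple of \<open>p^2\<close> shifts the quotient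
  by a multiple of p. Sums can thus be treated without reducing them first.\<close>

lemma gray_of_int:
  "gray Y (of_int U :: 'p::prime_card zp2) t = of_int (U div int CARD('p)) + of_int U * Y t"
proof -
  let ?p = "int CARD('p)"
  let ?u = "of_int U :: 'p zp2"
  have p: "?p > 0" by simp
  have U: "to_int_mod_ring ?u = U mod (?p * ?p)"
    unfolding of_int_of_int_mod_ring by transfer simp
  have "U mod (?p * ?p) = ?p * (U div ?p mod ?p) + U mod ?p"
    by (rule zmod_zmult2_eq) simp
  then have "to_int_mod_ring ?u div ?p = U div ?p mod ?p"
    unfolding U using p by (simp add: div_add1_eq)
  moreover have "to_int_mod_ring ?u mod ?p = U mod ?p"
    unfolding U by (simp add: mod_mod_cancel)
  moreover have mod: "(of_int (V mod ?p) :: 'p zp) = of_int V" for V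
    by (metis of_int_to_int_mod_ring to_int_of_int_mod_ring)
  ultimately show ?thesis
    unfolding gray_def by (simp only: mod)
qed

lemma gray_to_int:
  "gray Y u t = of_int (to_int_mod_ring u div int CARD('p)) + digit u * Y t"
  for u :: "'p::prime_card zp2"
  using gray_of_int[of Y "to_int_mod_ring u" t] by (simp add: digit_def)

text \<open>Adding a multiple of p produces no carry.\<close>

lemma gray_add:
  fixes u v :: "'p::prime_card zp2"
  assumes "digit v = 0"
  shows "gray Y (u + v) t = gray Y u t + gray Y v t"
proof -
  let ?U = "to_int_mod_ring u" and ?V = "to_int_mod_ring v"
  have "int CARD('p) dvd ?V"
    using assms unfolding digit_def of_int_mod_ring_eq_0_iff .
  then have "(?U + ?V) div int CARD('p) = ?U div int CARD('p) + ?V div int CARD('p)"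
    by (rule div_plus_div_distrib_dvd_right)
  then show ?thesis
    using gray_of_int[of Y "?U + ?V" t] gray_of_int[of Y ?U t] gray_of_int[of Y ?V t]
    by (simp add: algebra_simps)
qed

lemma gray_eq_0_imp:
  fixes u :: "'p::prime_card zp2"
  assumes "digit u = 0" "gray Y u t = 0"
  shows "u = 0"
proof -
  let ?U = "to_int_mod_ring u" and ?p = "int CARD('p)"
  have 1: "?p dvd ?U" using assms(1) unfolding digit_def of_int_mod_ring_eq_0_iff .
  have "(of_int (?U div ?p) :: 'p zp) = 0" using assms unfolding gray_to_int by simp
  then have "?p dvd ?U div ?p" unfolding of_int_mod_ring_eq_0_iff .
  with 1 have "?p * ?p dvd ?U" by (auto elim!: dvdE)
  moreover have "?U \<in> range (to_int_mod_ring :: 'p zp2 \<Rightarrow> int)" by simp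
  then have "0 \<le> ?U" "?U < ?p * ?p"
    unfolding range_to_int_mod_ring by auto
  ultimately have "?U = 0"
    using zdvd_not_zless by force
  then show "u = 0" by simp
qed

definition digits :: "'p::prime_card mixed_vec \<Rightarrow> nat \<Rightarrow> 'p zp" where
  "digits c i = digit (snd c i)"

text \<open>Repeated addition. Scalars act through natural numbers since the second component is not
  a vector space over Z_p.\<close>

definition nat_scale :: "nat \<Rightarrow> 'p::prime_card mixed_vec \<Rightarrow> 'p mixed_vec" where
  "nat_scale n c = (\<lambda>i. of_nat n * fst c i, \<lambda>i. of_nat n * snd c i)"

lemma digits_add: "digits (x + y) = digits x + digits y"
  by (auto simp: digits_def digit_add fun_eq_iff)

lemma digits_diff: "digits (x - y) = digits x - digits y"
  by (auto simp: digits_def digit_diff fun_eq_iff)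

lemma digits_0: "digits 0 = 0"
  using digits_diff[of 0 0] by simp

lemma digits_sum: "digits (\<Sum>a\<in>A. f a) = (\<Sum>a\<in>A. digits (f a))"
  by (induction A rule: infinite_finite_induct) (simp_all only: sum.infinite sum.empty sum.insert not_False_eq_True digits_0 digits_add)

lemma digits_nat_scale: "digits (nat_scale n c) = vscale (of_nat n) (digits c)"
  by (auto simp: digits_def nat_scale_def digit_of_nat_mult fun_eq_iff)

lemma Gray_add:
  assumes "digits t = 0"
  shows "Gray Y \<alpha> \<beta> (c + t) = Gray Y \<alpha> \<beta> c + Gray Y \<alpha> \<beta> t"
  using assms by (auto simp: Gray_def fun_eq_iff gray_add digits_def)

lemma Gray_in_vecs: "Gray Y \<alpha> \<beta> (c :: 'p::prime_card mixed_vec) \<in> vecs (\<alpha> + CARD('p) * \<beta>)"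
  by (auto simp: Gray_def vecs_def)

section \<open>Rank and kernel of a Gray image\<close>

locale gray_code =
  fixes Y :: "nat \<Rightarrow> 'p::prime_card zp" and \<alpha> \<beta> :: nat and \<C> :: "'p mixed_vec set"
  assumes Y: "bij_betw Y {..<CARD('p)} UNIV"
    and additive: "additive_code \<alpha> \<beta> \<C>"
begin

abbreviation "\<Phi> \<equiv> Gray Y \<alpha> \<beta>"
abbreviation "ker_code \<equiv> code_kernel (\<alpha> + CARD('p) * \<beta>) (\<Phi> ` \<C>)"

lemma code_subset: "\<C> \<subseteq> vecs \<alpha> \<times> vecs \<beta>"
  using additive subgroup.subset[of \<C> "mixed_group \<alpha> \<beta>"]
  by (auto simp: additive_code_def mixed_group_def)

lemma code_0: "0 \<in> \<C>"
  using additive subgroup.one_closed[of \<C> "mixed_group \<alpha> \<beta>"]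
  by (auto simp: additive_code_def mixed_group_def)

lemma code_add: "x \<in> \<C> \<Longrightarrow> y \<in> \<C> \<Longrightarrow> x + y \<in> \<C>"
  using additive subgroup.m_closed[of \<C> "mixed_group \<alpha> \<beta>" x y]
  by (auto simp: additive_code_def mixed_group_def)

lemma code_uminus:
  assumes "x \<in> \<C>"
  shows "- x \<in> \<C>"
proof -
  interpret comm_group "mixed_group \<alpha> \<beta> :: 'p mixed_vec monoid"
    by (rule comm_group_mixed_group)
  have "inv\<^bsub>mixed_group \<alpha> \<beta>\<^esub> x = - x"
    using assms code_subset by (intro inv_equality) (auto simp: mixed_group_def vecs_def)
  then show ?thesis
    using subgroup.m_inv_closed[of \<C> "mixed_group \<alpha> \<beta>" x] additive assms
    by (simp add: additive_code_def)
qed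

lemma code_diff: "x \<in> \<C> \<Longrightarrow> y \<in> \<C> \<Longrightarrow> x - y \<in> \<C>"
  using code_add[OF _ code_uminus, of x y] by simp

lemma code_sum: "(\<And>a. a \<in> A \<Longrightarrow> f a \<in> \<C>) \<Longrightarrow> (\<Sum>a\<in>A. f a) \<in> \<C>"
  by (induction A rule: infinite_finite_induct) (auto simp del: zero_prod_def simp: code_0 code_add)

lemma code_nat_scale:
  assumes "c \<in> \<C>"
  shows "nat_scale n c \<in> \<C>"
proof (induction n)
  case 0
  have "nat_scale 0 c = 0" by (auto simp: nat_scale_def zero_prod_def fun_eq_iff)
  then show ?case by (simp only: code_0)
next
  case (Suc n)
  have "nat_scale (Suc n) c = c + nat_scale n c"
    by (auto simp: nat_scale_def prod_eq_iff fun_eq_iff algebra_simps)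
  then show ?case using assms Suc by (simp only: code_add)
qed

lemma finite_code: "finite \<C>"
  by (rule finite_subset[OF code_subset]) (simp add: finite_card_vecs)

text \<open>A linear map recovering the low digits: the block of \<open>u\<close> differs by \<open>u\<^sub>0\<close> between the positions
  where \<open>Y\<close> is 1 and 0.\<close>

definition detect :: "(nat \<Rightarrow> 'p zp) \<Rightarrow> nat \<Rightarrow> 'p zp" where
  "detect x i = (if i < \<beta>
     then x (\<alpha> + CARD('p) * i + inv_into {..<CARD('p)} Y 1) - x (\<alpha> + CARD('p) * i + inv_into {..<CARD('p)} Y 0)
     else 0)"

lemma detect_add: "detect (x + y) = detect x + detect y"
  and detect_diff: "detect (x - y) = detect x - detect y"
  and detect_vscale: "detect (vscale c x) = vscale c (detect x)"
  by (auto simp: detect_def fun_eq_iff algebra_simps)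

lemma Gray_block:
  assumes "i < \<beta>" "t < CARD('p)"
  shows "\<Phi> c (\<alpha> + CARD('p) * i + t) = gray Y (snd c i) t"
proof -
  have "CARD('p) * i + t < CARD('p) * Suc i" using assms by simp
  also have "\<dots> \<le> CARD('p) * \<beta>" using assms by (intro mult_le_mono2) simp
  finally show ?thesis using assms by (simp add: Gray_def)
qed

lemma detect_Gray:
  assumes "c \<in> \<C>"
  shows "detect (\<Phi> c) = digits c"
proof
  fix i
  \<comment> \<open>Since \<open>Y\<close> is a bijection, every field element has a position below
    p.\<close>
  have inv: "inv_into {..<CARD('p)} Y s < CARD('p)" "Y (inv_into {..<CARD('p)} Y s) = s" for s
    using Y by (auto simp: bij_betw_def f_inv_into_f intro!: inv_into_into[of s Y "{..<CARD('p)}", simplified])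
  show "detect (\<Phi> c) i = digits c i"
  proof (cases "i < \<beta>")
    case True
    then show ?thesis
      by (simp add: detect_def Gray_block inv gray_to_int digits_def)
  next
    case False
    then have "snd c i = 0" using assms code_subset by (auto simp: vecs_def)
    then show ?thesis using False by (simp add: detect_def digits_def digit_def)
  qed
qed

lemma Gray_eq_0_imp:
  assumes "c \<in> \<C>" "digits c = 0" "\<Phi> c = 0"
  shows "c = 0"
proof -
  have "fst c i = 0" for i
    using assms(1) code_subset fun_cong[OF assms(3), of i]
    by (cases "i < \<alpha>") (auto simp: Gray_def vecs_def)
  moreover have "snd c i = 0" for i
  proof (cases "i < \<beta>")
    case True
    \<comment> \<open>A block with vanishing low digit is constant, so one position decides.\<close>
    have "gray Y (snd c i) 0 = 0"
      using Gray_block[OF True, of 0 c] assms(3) by simp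
    then show ?thesis
      using gray_eq_0_imp fun_cong[OF assms(2), of i] by (auto simp: digits_def)
  next
    case False
    then show ?thesis using assms(1) code_subset by (auto simp: vecs_def)
  qed
  ultimately show ?thesis by (auto simp: prod_eq_iff fun_eq_iff)
qed

text \<open>The Gray map is not additive, but \<open>detect\<close> shows that \<open>x\<close> and
  \<open>y\<close> have the same low digits; then no carry occurs in
  \<open>y + (x - y)\<close>.\<close>

lemma inj_on_Gray: "inj_on \<Phi> \<C>"
proof (rule inj_onI)
  fix x y assume xy: "x \<in> \<C>" "y \<in> \<C>" "\<Phi> x = \<Phi> y"
  then have d: "digits (x - y) = 0"
    using detect_Gray by (metis digits_diff diff_self)
  have "\<Phi> (y + (x - y)) = \<Phi> y + \<Phi> (x - y)"
    by (rule Gray_add[OF d])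
  then have "\<Phi> (x - y) = 0" using xy by simp
  then have "x - y = 0"
    using xy d by (intro Gray_eq_0_imp code_diff)
  then show "x = y" by simp
qed

lemma Gray_0: "\<Phi> 0 = 0"
  using Gray_add[OF digits_0, of Y \<alpha> \<beta> 0] by simp

section \<open>The translation kernel of the Gray image\<close>

lemma finite_image: "finite (\<Phi> ` \<C>)"
  using finite_code by simp

lemma image_subset_vecs: "\<Phi> ` \<C> \<subseteq> vecs (\<alpha> + CARD('p) * \<beta>)"
  using Gray_in_vecs by auto

text \<open>Translation is injective, so mapping a finite set into itself already means
  onto.\<close>

lemma kernel_memI:
  assumes "x \<in> vecs (\<alpha> + CARD('p) * \<beta>)" and "\<And>c. c \<in> \<Phi> ` \<C> \<Longrightarrow> c + x \<in> \<Phi> ` \<C>"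
  shows "x \<in> ker_code"
proof -
  have "(\<lambda>c. c + x) ` (\<Phi> ` \<C>) \<subseteq> \<Phi> ` \<C>" using assms(2) by auto
  moreover have "inj_on (\<lambda>c. c + x) (\<Phi> ` \<C>)" by simp
  ultimately have "(\<lambda>c. c + x) ` (\<Phi> ` \<C>) = \<Phi> ` \<C>"
    using finite_image by (intro endo_inj_surj) auto
  then show ?thesis using assms(1) by (simp add: code_kernel_def)
qed

lemma kernel_memD: "x \<in> ker_code \<Longrightarrow> c \<in> \<Phi> ` \<C> \<Longrightarrow> c + x \<in> \<Phi> ` \<C>"
  by (auto simp: code_kernel_def)

lemma kernel_subset: "ker_code \<subseteq> \<Phi> ` \<C>"
proof
  fix x assume "x \<in> ker_code"
  then have "0 + x \<in> \<Phi> ` \<C>"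
    by (rule kernel_memD) (use code_0 Gray_0 in \<open>metis imageI\<close>)
  then show "x \<in> \<Phi> ` \<C>" by simp
qed

lemma finite_kernel: "finite ker_code"
  by (rule finite_subset[OF kernel_subset finite_image])

lemma kernel_0: "0 \<in> ker_code"
  by (rule kernel_memI) (auto simp: vecs_def)

lemma kernel_add:
  assumes "x \<in> ker_code" "y \<in> ker_code"
  shows "x + y \<in> ker_code"
proof (rule kernel_memI)
  show "x + y \<in> vecs (\<alpha> + CARD('p) * \<beta>)" using assms by (auto simp: code_kernel_def vecs_def)
  fix c assume "c \<in> \<Phi> ` \<C>"
  with assms have "c + x + y \<in> \<Phi> ` \<C>" by (intro kernel_memD)
  then show "c + (x + y) \<in> \<Phi> ` \<C>" by (simp add: add.assoc)
qed

text \<open>Every scalar of the prime field is a natural multiple of 1, so closure under addition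
  suffices.\<close>

lemma subspace_kernel: "vs.subspace ker_code"
proof (rule vs.subspaceI)
  fix c :: "'p zp" and x assume x: "x \<in> ker_code"
  have "vscale (of_nat n) x \<in> ker_code" for n
  proof (induction n)
    case 0
    have "vscale (of_nat 0) x = 0" by (auto simp: fun_eq_iff)
    then show ?case by (simp only: kernel_0)
  next
    case (Suc n)
    have "vscale (of_nat (Suc n)) x = x + vscale (of_nat n) x"
      by (auto simp: fun_eq_iff algebra_simps)
    then show ?case using x Suc by (simp only: kernel_add)
  qed
  then show "vscale c x \<in> ker_code" using surj_of_nat_mod_ring[of c] by auto
qed (use kernel_0 kernel_add in auto)

lemma torsion_in_kernel:
  assumes "t \<in> \<C>" "digits t = 0"
  shows "\<Phi> t \<in> ker_code"
proof (rule kernel_memI)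
  fix c assume "c \<in> \<Phi> ` \<C>"
  then obtain d where "d \<in> \<C>" "c = \<Phi> d" by auto
  then have "c + \<Phi> t = \<Phi> (d + t)" "d + t \<in> \<C>"
    using Gray_add[OF assms(2)] code_add assms(1) by auto
  then show "c + \<Phi> t \<in> \<Phi> ` \<C>" by blast
qed (rule Gray_in_vecs)

text \<open>High digits enter the Gray map as constant blocks; this linear map spreads one value
  over each block.\<close>

definition repeat :: "(nat \<Rightarrow> 'p zp) \<Rightarrow> nat \<Rightarrow> 'p zp" where
  "repeat b j = (if \<alpha> \<le> j \<and> j < \<alpha> + CARD('p) * \<beta> then b ((j - \<alpha>) div CARD('p)) else 0)"

lemma repeat_add: "repeat (x + y) = repeat x + repeat y"
  and repeat_vscale: "repeat (vscale c x) = vscale c (repeat x)"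
  and repeat_0: "repeat 0 = 0"
  by (auto simp: repeat_def fun_eq_iff)

lemma repeat_span:
  assumes "x \<in> vs.span A" "\<And>a. a \<in> A \<Longrightarrow> repeat a \<in> vs.span B"
  shows "repeat x \<in> vs.span B"
  using assms(1)
proof (induction rule: vs.span_induct_alt)
  case base
  show ?case by (simp only: repeat_0 vs.span_zero)
next
  case (step c a z)
  show ?case
    unfolding repeat_add repeat_vscale
    by (rule vs.span_add[OF vs.span_scale[OF assms(2)[OF step(1)]] step(2)])
qed

text \<open>The Gray image of \<open>p c\<close> repeats every digit of \<open>c\<close> in its block.\<close>

lemma repeat_digits_in_kernel:
  assumes "c \<in> \<C>"
  shows "repeat (digits c) \<in> ker_code"
proof -
  have "\<Phi> (nat_scale CARD('p) c) j = repeat (digits c) j" for j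
  proof -
    let ?u = "snd c ((j - \<alpha>) div CARD('p))"
    have "gray Y (of_nat CARD('p) * ?u) t = digit ?u" for t
    proof -
      have "of_nat CARD('p) * ?u = of_int (int CARD('p) * to_int_mod_ring ?u)" by simp
      then have "gray Y (of_nat CARD('p) * ?u) t = of_int (int CARD('p) * to_int_mod_ring ?u div int CARD('p)) +
          of_int (int CARD('p) * to_int_mod_ring ?u) * Y t"
        by (simp only: gray_of_int)
      moreover have "(of_int (int CARD('p) * to_int_mod_ring ?u) :: 'p zp) = 0"
        unfolding of_int_mod_ring_eq_0_iff by simp
      ultimately show ?thesis by (simp add: digit_def)
    qed
    then show ?thesis
      by (simp add: Gray_def repeat_def nat_scale_def digits_def)
  qed
  then have "\<Phi> (nat_scale CARD('p) c) = repeat (digits c)" by auto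
  moreover have "digits (nat_scale CARD('p) c) = 0"
    by (simp add: digits_nat_scale fun_eq_iff)
  ultimately show ?thesis
    using torsion_in_kernel[OF code_nat_scale[OF assms], of "CARD('p)"] by simp
qed

section \<open>Low digits of the code and of its kernel\<close>

lemma subspace_digits: "vs.subspace (digits ` \<C>)"
proof (rule vs.subspaceI)
  show "0 \<in> digits ` \<C>" using code_0 digits_0 by (metis imageI)
next
  fix x y assume "x \<in> digits ` \<C>" "y \<in> digits ` \<C>"
  then show "x + y \<in> digits ` \<C>"
    using code_add digits_add by (metis (no_types, lifting) imageE imageI)
next
  fix c :: "'p zp" and x assume "x \<in> digits ` \<C>"
  then obtain d where d: "d \<in> \<C>" "x = digits d" by auto
  obtain n where "c = of_nat n" using surj_of_nat_mod_ring[of c] by auto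
  with d have "vscale c x = digits (nat_scale n d)" by (simp add: digits_nat_scale)
  then show "vscale c x \<in> digits ` \<C>" using d code_nat_scale by blast
qed

lemma subspace_detect_kernel: "vs.subspace (detect ` ker_code)"
proof (rule vs.subspaceI)
  have "detect 0 = 0" using detect_diff[of 0 0] by simp
  then show "0 \<in> detect ` ker_code" using kernel_0 by (metis imageI)
next
  fix x y assume "x \<in> detect ` ker_code" "y \<in> detect ` ker_code"
  then obtain a b where "a \<in> ker_code" "x = detect a" "b \<in> ker_code" "y = detect b" by blast
  then show "x + y \<in> detect ` ker_code"
    by (intro image_eqI[of _ _ "a + b"]) (simp_all only: detect_add kernel_add)
next
  fix c x assume "x \<in> detect ` ker_code"
  then obtain a where "a \<in> ker_code" "x = detect a" by blast
  then show "vscale c x \<in> detect ` ker_code"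
    by (intro image_eqI[of _ _ "vscale c a"])
      (simp_all only: detect_vscale vs.subspace_scale[OF subspace_kernel])
qed

lemma detect_kernel_subset: "detect ` ker_code \<subseteq> digits ` \<C>"
  using kernel_subset detect_Gray by auto

text \<open>Both maps have the Gray image of the torsion subcode as their kernel, so cardinalities of
  the images compare like those of the codes.\<close>

lemma card_digits:
  assumes "card ker_code * n = card \<C>"
  shows "card (detect ` ker_code) * n = card (digits ` \<C>)"
proof -
  let ?T = "{t \<in> \<C>. digits t = 0}"
  have "{x \<in> ker_code. detect x = 0} = \<Phi> ` ?T"
  proof (intro equalityI subsetI)
    fix x assume x: "x \<in> {x \<in> ker_code. detect x = 0}"
    then obtain c where c: "c \<in> \<C>" "x = \<Phi> c" using kernel_subset by auto
    with x have "digits c = 0" using detect_Gray[of c] by simp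
    with c show "x \<in> \<Phi> ` ?T" by blast
  next
    fix x assume "x \<in> \<Phi> ` ?T"
    then obtain t where "t \<in> \<C>" "digits t = 0" "x = \<Phi> t" by blast
    then show "x \<in> {x \<in> ker_code. detect x = 0}"
      using torsion_in_kernel[of t] detect_Gray[of t] by simp
  qed
  moreover have "card (\<Phi> ` ?T) = card ?T"
    by (rule card_image) (rule inj_on_subset[OF inj_on_Gray], auto)
  ultimately have ker: "card ker_code = card (detect ` ker_code) * card ?T"
    using card_additive_image[where f = detect, OF finite_kernel kernel_0 vs.subspace_diff[OF subspace_kernel]]
    by (simp add: detect_diff)
  have code: "card \<C> = card (digits ` \<C>) * card ?T"
    by (rule card_additive_image[where f = digits, OF finite_code code_0 code_diff digits_diff])
  have nonzero: "card A \<noteq> 0" if "x \<in> A" "finite A" for x and A :: "'p mixed_vec set"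
    using that by auto
  have "0 \<in> ?T" by (rule CollectI) (rule conjI[OF code_0 digits_0])
  then have T: "card ?T \<noteq> 0"
    by (rule nonzero) (rule rev_finite_subset[OF finite_code Collect_restrict])
  \<comment> \<open>Cancels the number of torsion words, a common factor of both
    cardinalities.\<close>
  have cancel: "v * n = w" if "a = v * t" "b = w * t" "t \<noteq> 0" "a * n = b" for a b v w t :: nat
    using that by auto
  show ?thesis by (rule cancel[OF ker code T assms])
qed

section \<open>The upper bound for the rank\<close>

lemma card_subspace_zp:
  "vs.subspace V \<Longrightarrow> finite V \<Longrightarrow> card V = CARD('p) ^ vs.dim V" for V :: "(nat \<Rightarrow> 'p zp) set"
  using vs.card_subspace[where 'a = "'p zp", of V] by simp

text \<open>The first \<alpha> coordinates and the multiples of \<open>Y\<close> behave linearly;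
  only the carries deviate, and they are constant on blocks. By \<open>span_div_sum\<close> they are
  spanned by \<open>S\<close> and the carry monomials.\<close>

lemma Gray_sum_nat_scale:
  assumes p: "CARD('p) > 2" and "finite S" and g: "\<And>v. v \<in> S \<Longrightarrow> g v \<in> \<C> \<and> digits (g v) = v"
  shows "\<Phi> (\<Sum>v\<in>S. nat_scale (m v) (g v)) - (\<Sum>v\<in>S. vscale (of_nat (m v)) (\<Phi> (g v)))
    \<in> vs.span (ker_code \<union> repeat ` carry_monomials CARD('p) S)" (is "?lhs \<in> vs.span ?Z")
proof -
  have odd: "odd CARD('p)"
    using prime_odd_nat[OF prime_card p] .
  define G where "G v i = to_int_mod_ring (snd (g v) i)" for v i
  have G: "of_int (G v i) = v i" if "v \<in> S" for v i
    using g[OF that] by (auto simp: G_def digits_def digit_def fun_eq_iff)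
  define d where "d = (\<lambda>i. of_int ((\<Sum>v\<in>S. int (m v) * G v i) div int CARD('p))) -
      (\<Sum>v\<in>S. vscale (of_int (int (m v))) (\<lambda>i. of_int (G v i div int CARD('p)) :: 'p zp))"
  have "d \<in> vs.span (S \<union> carry_monomials CARD('p) S)"
    unfolding d_def by (rule span_div_sum[OF odd p assms(2)]) (rule G)
  then have "repeat d \<in> vs.span ?Z"
  proof (rule repeat_span)
    fix a assume "a \<in> S \<union> carry_monomials CARD('p) S"
    \<comment> \<open>A vector of \<open>S\<close> consists of the low digits of a codeword, so
      repeating it gives a kernel element.\<close>
    then have "repeat a \<in> ?Z"
      using repeat_digits_in_kernel g by fastforce
    then show "repeat a \<in> vs.span ?Z" by (rule vs.span_base)
  qed
  moreover have "?lhs = repeat d"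
  proof
    fix j
    let ?i = "(j - \<alpha>) div CARD('p)" and ?t = "(j - \<alpha>) mod CARD('p)"
    let ?e = "\<Sum>v\<in>S. nat_scale (m v) (g v)"
    have fst: "fst ?e j = (\<Sum>v\<in>S. of_nat (m v) * fst (g v) j)"
      by (simp add: fst_sum nat_scale_def)
    have "snd ?e ?i = of_int (\<Sum>v\<in>S. int (m v) * G v ?i)"
      by (simp add: snd_sum nat_scale_def G_def)
    then have "gray Y (snd ?e ?i) ?t = of_int ((\<Sum>v\<in>S. int (m v) * G v ?i) div int CARD('p)) +
        (\<Sum>v\<in>S. of_nat (m v) * v ?i) * Y ?t"
      by (simp only: gray_of_int) (simp add: G)
    moreover have "gray Y (snd (g v) ?i) ?t = of_int (G v ?i div int CARD('p)) + v ?i * Y ?t"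
      if "v \<in> S" for v
      using G[OF that, of ?i] by (simp add: gray_to_int G_def digit_def)
    ultimately have "gray Y (snd ?e ?i) ?t - (\<Sum>v\<in>S. of_nat (m v) * gray Y (snd (g v) ?i) ?t) = d ?i"
      by (simp add: d_def distrib_left sum.distrib sum_distrib_right mult.assoc)
    with fst show "?lhs j = repeat d j"
      by (simp add: Gray_def repeat_def)
  qed
  ultimately show ?thesis by simp
qed

text \<open>If \<open>y\<close> is the codeword with image \<open>\<Phi> e + x\<close>, then
  \<open>c\<close> and \<open>y\<close> have the same low digits, so the difference is
  \<open>x\<close> plus the image of the torsion word \<open>c - y\<close>.\<close>

lemma Gray_decompose:
  assumes c: "c \<in> \<C>" and e: "e \<in> \<C>" and x: "x \<in> ker_code" and d: "digits c = digits e + detect x"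
  shows "\<Phi> c - \<Phi> e \<in> ker_code"
proof -
  obtain y where y: "y \<in> \<C>" "\<Phi> e + x = \<Phi> y"
    using kernel_memD[OF x, of "\<Phi> e"] e by auto
  have "digits y = detect (\<Phi> e + x)" using y detect_Gray by simp
  also have "\<dots> = digits c" using e detect_Gray d by (simp only: detect_add)
  finally have t: "digits (c - y) = 0" by (simp add: digits_diff)
  have "\<Phi> (y + (c - y)) = \<Phi> y + \<Phi> (c - y)" by (rule Gray_add[OF t])
  then have "\<Phi> c - \<Phi> e = x + \<Phi> (c - y)"
    using y(2)[symmetric] by (simp add: algebra_simps)
  moreover have "\<Phi> (c - y) \<in> ker_code"
    using torsion_in_kernel[OF code_diff[OF c y(1)] t] .
  ultimately show ?thesis using x kernel_add by simp
qed

text \<open>Modulo the kernel only low digits matter, and those of the kernel have codimension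
  \<open>k\<close>. Codewords lifting a complementary basis \<open>S\<close> therefore generate the
  rest, up to carries.\<close>

lemma rank_le:
  assumes p: "CARD('p) > 2" and card: "card ker_code * CARD('p) ^ k = card \<C>"
  obtains S :: "(nat \<Rightarrow> 'p zp) set" where "finite S" "card S = k"
    "code_rank (\<Phi> ` \<C>) \<le> vs.dim ker_code + k + card (carry_monomials CARD('p) S)"
proof -
  let ?W = "digits ` \<C>" and ?V = "detect ` ker_code"
  have fin: "finite ?W" "finite ?V" using finite_code finite_kernel by auto
  have p1: "CARD('p) > 1" using p by simp
  have "CARD('p) ^ (vs.dim ?V + k) = CARD('p) ^ vs.dim ?W"
    using card_digits[OF card] card_subspace_zp[OF subspace_digits fin(1)]
      card_subspace_zp[OF subspace_detect_kernel fin(2)]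
    by (simp add: power_add)
  then have dim: "vs.dim ?V + k = vs.dim ?W"
    using p1 by (simp only: power_inject_exp)
  obtain B1 where B1: "B1 \<subseteq> ?V" "vs.independent B1" "?V \<subseteq> vs.span B1" "card B1 = vs.dim ?V"
    by (rule vs.basis_exists)
  \<comment> \<open>A basis of the low digits of the kernel is extended to all low digits; the added
    vectors form \<open>S\<close>.\<close>
  obtain B where B: "B1 \<subseteq> B" "B \<subseteq> ?W" "vs.independent B" "?W \<subseteq> vs.span B"
    by (rule vs.maximal_independent_subset_extend[OF order.trans[OF B1(1) detect_kernel_subset] B1(2)])
  define S where "S = B - B1"
  have finB: "finite B" "finite B1" "finite S"
    unfolding S_def using finite_subset[OF B(2) fin(1)] finite_subset[OF B1(1) fin(2)] by auto
  have cardS: "card S = k"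
    using card_Diff_subset[OF finB(2) B(1)] vs.basis_card_eq_dim[OF B(2,4,3)] B1(4) dim
    by (simp add: S_def)
  have "\<forall>v\<in>S. \<exists>c\<in>\<C>. digits c = v" using B by (auto simp: S_def)
  then obtain g where g: "\<And>v. v \<in> S \<Longrightarrow> g v \<in> \<C> \<and> digits (g v) = v"
    by metis
  obtain B0 where B0: "B0 \<subseteq> ker_code" "vs.independent B0" "ker_code \<subseteq> vs.span B0" "card B0 = vs.dim ker_code"
    by (rule vs.basis_exists)
  \<comment> \<open>The three parts give the three summands of the bound.\<close>
  define M where "M = B0 \<union> \<Phi> ` g ` S \<union> repeat ` carry_monomials CARD('p) S"
  have finM: "finite M"
    unfolding M_def using finite_subset[OF B0(1) finite_kernel] finB(3) finite_carry_monomials[OF finB(3)]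
    by auto
  have ker: "ker_code \<subseteq> vs.span M"
    using B0(3) vs.span_mono[of B0 M] by (auto simp: M_def)
  have "\<Phi> c \<in> vs.span M" if c: "c \<in> \<C>" for c
  proof -
    have "digits c \<in> vs.span (S \<union> B1)"
      using c B by (auto simp: S_def Un_absorb2)
    then obtain s a where sa: "s \<in> vs.span S" "a \<in> vs.span B1" "digits c = s + a"
      by (auto simp: vs.span_Un)
    have "vs.span B1 = ?V"
      using B1 subspace_detect_kernel by (simp add: vs.span_subspace)
    with sa obtain x where x: "x \<in> ker_code" "a = detect x" by auto
    obtain u where u: "s = (\<Sum>v\<in>S. vscale (u v) v)"
      using sa(1) by (auto simp: vs.span_finite[OF finB(3)])
    have "\<forall>v. \<exists>n. u v = of_nat n" using surj_of_nat_mod_ring by blast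
    then obtain m where m: "\<And>v. u v = of_nat (m v)" by metis
    \<comment> \<open>A codeword with low digits \<open>s\<close>, so those of \<open>c\<close>
      differ from its own by low digits of a kernel element.\<close>
    define e where "e = (\<Sum>v\<in>S. nat_scale (m v) (g v))"
    have e: "e \<in> \<C>"
      unfolding e_def using g by (intro code_sum code_nat_scale) auto
    have "digits e = s"
      unfolding e_def digits_sum u using g m by (intro sum.cong) (auto simp: digits_nat_scale)
    then have 1: "\<Phi> c - \<Phi> e \<in> vs.span M"
      using Gray_decompose[OF c e x(1)] sa(3) x(2) ker by auto
    have "ker_code \<union> repeat ` carry_monomials CARD('p) S \<subseteq> vs.span M"
      using ker by (auto simp: M_def intro: vs.span_base)
    then have "vs.span (ker_code \<union> repeat ` carry_monomials CARD('p) S) \<subseteq> vs.span M"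
      by (rule vs.span_minimal) simp
    then have 2: "\<Phi> e - (\<Sum>v\<in>S. vscale (of_nat (m v)) (\<Phi> (g v))) \<in> vs.span M"
      using Gray_sum_nat_scale[OF p finB(3) g] unfolding e_def by blast
    have 3: "(\<Sum>v\<in>S. vscale (of_nat (m v)) (\<Phi> (g v))) \<in> vs.span M"
      by (intro vs.span_sum vs.span_scale vs.span_base) (auto simp: M_def)
    show ?thesis
      using vs.span_add[OF 1 vs.span_add[OF 2 3]] by simp
  qed
  then have "vs.span (\<Phi> ` \<C>) \<subseteq> vs.span M"
    by (intro vs.span_minimal) auto
  then have "code_rank (\<Phi> ` \<C>) \<le> card M"
    unfolding code_rank_def by (rule vs.dim_le_card[OF _ finM])
  also have "card M \<le> card B0 + card (\<Phi> ` g ` S) + card (repeat ` carry_monomials CARD('p) S)"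
    unfolding M_def using card_Un_le[of B0 "\<Phi> ` g ` S"]
      card_Un_le[of "B0 \<union> \<Phi> ` g ` S" "repeat ` carry_monomials CARD('p) S"] by linarith
  also have "\<dots> \<le> vs.dim ker_code + k + card (carry_monomials CARD('p) S)"
    using B0(4) cardS card_image_le[OF finB(3), of g] card_image_le[of "g ` S" \<Phi>] finB(3)
      card_image_le[OF finite_carry_monomials[OF finB(3)], of repeat]
    by (intro add_mono) (auto intro: order.trans)
  finally show ?thesis using that finB(3) cardS by blast
qed

section \<open>Linear and nonlinear Gray images\<close>

lemma linear_code:
  assumes "vs.subspace (\<Phi> ` \<C>)"
  shows "ker_code = \<Phi> ` \<C>" "code_rank (\<Phi> ` \<C>) = vs.dim (\<Phi> ` \<C>)"
proof -
  have "\<Phi> ` \<C> \<subseteq> ker_code"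
    using image_subset_vecs assms by (auto intro!: kernel_memI intro: vs.subspace_add)
  then show "ker_code = \<Phi> ` \<C>" using kernel_subset by auto
  show "code_rank (\<Phi> ` \<C>) = vs.dim (\<Phi> ` \<C>)"
    using assms by (simp add: code_rank_def)
qed

text \<open>A code that is not a subspace is a proper subset of its span, which is finite, and the
  Gray map preserves the size of the code.\<close>

lemma rank_gt:
  assumes "\<not> vs.subspace (\<Phi> ` \<C>)"
  shows "card \<C> < CARD('p) ^ code_rank (\<Phi> ` \<C>)"
proof -
  have fin: "finite (vs.span (\<Phi> ` \<C>))"
  proof (rule finite_subset)
    show "vs.span (\<Phi> ` \<C>) \<subseteq> vecs (\<alpha> + CARD('p) * \<beta>)"
      by (intro vs.span_minimal image_subset_vecs vs.subspaceI) (auto simp: vecs_def)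
  qed (rule finite_card_vecs)
  have "\<Phi> ` \<C> \<subset> vs.span (\<Phi> ` \<C>)"
    using assms vs.span_superset vs.subspace_span by (metis psubsetI)
  then have "card (\<Phi> ` \<C>) < card (vs.span (\<Phi> ` \<C>))"
    by (rule psubset_card_mono[OF fin])
  then show ?thesis
    using card_subspace_zp[OF vs.subspace_span fin] card_image[OF inj_on_Gray]
    by (simp add: code_rank_def)
qed

end

text \<open>The isomorphism preserves cardinality, and each coordinate modulo \<open>p^2\<close>
  counts twice in the exponent.\<close>

lemma card_code_of_type:
  fixes \<C> :: "'p::prime_card mixed_vec set"
  assumes "code_of_type \<alpha> \<beta> \<gamma> \<delta> \<kappa> \<C>"
  shows "card \<C> = CARD('p) ^ (\<gamma> + 2 * \<delta>)"
proof -
  obtain h where "h \<in> iso ((mixed_group \<alpha> \<beta>)\<lparr>carrier := \<C>\<rparr>) (mixed_group \<gamma> \<delta> :: 'p mixed_vec monoid)"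
    using assms by (auto simp: code_of_type_def is_iso_def)
  then have "bij_betw h \<C> (carrier (mixed_group \<gamma> \<delta> :: 'p mixed_vec monoid))"
    by (simp add: iso_def)
  then have "card \<C> = card ((vecs \<gamma> \<times> vecs \<delta>) :: 'p mixed_vec set)"
    by (auto dest: bij_betw_same_card simp: mixed_group_def)
  also have "\<dots> = CARD('p) ^ \<gamma> * (CARD('p) * CARD('p)) ^ \<delta>"
    by (simp add: card_cartesian_product finite_card_vecs)
  also have "\<dots> = CARD('p) ^ (\<gamma> + 2 * \<delta>)"
    by (simp add: power_add power_mult power2_eq_square)
  finally show ?thesis .
qed

theorem lemma8:
  fixes \<C> :: "'p::prime_card mixed_vec set"
    and C :: "(nat \<Rightarrow> 'p zp) set"
    and Y :: "nat \<Rightarrow> 'p zp"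
    and p \<alpha> \<beta> \<gamma> \<delta> \<kappa> k :: nat
    and r :: int
    and L :: "nat set"
  assumes "p = CARD('p)" and "p > 2"
    and "bij_betw Y {..<p} UNIV"
    and "code_of_type \<alpha> \<beta> \<gamma> \<delta> \<kappa> \<C>"
    and "C = Gray Y \<alpha> \<beta> ` \<C>"
    and "L = {1 + 2 * m | m. 1 \<le> m \<and> m \<le> (p - 1) div 2} \<union> {p - 1}"
    and "int (code_rank C) = int (\<gamma> + 2 * \<delta>) + r"
    and "int (code_ker (\<alpha> + p * \<beta>) C) = int (\<gamma> + 2 * \<delta>) - int k"
  shows "(k \<in> {1..\<delta>} \<longrightarrow> 1 \<le> r \<and> r \<le> (\<Sum>l\<in>L. int ((k + l - 1) choose l)) - int k)
       \<and> (k = 0 \<longrightarrow> r = 0)"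
proof -
  interpret gray_code Y \<alpha> \<beta> \<C>
    using assms by unfold_locales (auto simp: code_of_type_def)
  let ?n = "\<gamma> + 2 * \<delta>"
  have p2: "CARD('p) > 2" using assms by simp
  have odd: "odd CARD('p)" using prime_odd_nat[OF prime_card p2] .
  have L: "L = gray_degrees CARD('p)"
    using assms by (simp add: gray_degrees_def)
  have cardC: "card \<C> = CARD('p) ^ ?n"
    by (rule card_code_of_type[OF assms(4)])
  have ker: "vs.dim ker_code + k = ?n"
    using assms(1,5,8) by (simp add: code_ker_def)
  have card_ker: "card ker_code = CARD('p) ^ vs.dim ker_code"
    by (rule card_subspace_zp[OF subspace_kernel finite_kernel])
  have rank: "int (code_rank (\<Phi> ` \<C>)) = int ?n + r"
    using assms by simp
  show ?thesis
  proof (intro conjI impI)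
    assume "k = 0"
    \<comment> \<open>The kernel is as large as the code, hence equal to it; the code is then linear
      and its rank is its dimension.\<close>
    then have "card ker_code = card (\<Phi> ` \<C>)"
      using card_ker ker cardC card_image[OF inj_on_Gray] by simp
    then have eq: "ker_code = \<Phi> ` \<C>"
      using card_subset_eq[OF finite_image kernel_subset] by simp
    then have "vs.subspace (\<Phi> ` \<C>)" using subspace_kernel by simp
    then show "r = 0" using linear_code(2) eq ker rank \<open>k = 0\<close> by simp
  next
    assume k: "k \<in> {1..\<delta>}"
    \<comment> \<open>A linear code would be its own kernel, but for positive \<open>k\<close> the
      kernel is strictly smaller.\<close>
    have "\<not> vs.subspace (\<Phi> ` \<C>)"
    proof
      assume "vs.subspace (\<Phi> ` \<C>)"
      then have "ker_code = \<Phi> ` \<C>" by (rule linear_code(1))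
      then have "CARD('p) ^ vs.dim ker_code = CARD('p) ^ ?n"
        using card_ker cardC card_image[OF inj_on_Gray] by simp
      then show False using ker k p2 by simp
    qed
    then have "CARD('p) ^ ?n < CARD('p) ^ code_rank (\<Phi> ` \<C>)"
      using rank_gt cardC by simp
    then have "?n < code_rank (\<Phi> ` \<C>)"
      using p2 power_strict_increasing_iff[of "CARD('p)" ?n] by simp
    then show "1 \<le> r" using rank by linarith
    have "card ker_code * CARD('p) ^ k = card \<C>"
      unfolding card_ker cardC using ker by (simp add: power_add[symmetric])
    then obtain S :: "(nat \<Rightarrow> 'p zp) set" where S: "finite S" "card S = k"
      "code_rank (\<Phi> ` \<C>) \<le> vs.dim ker_code + k + card (carry_monomials CARD('p) S)"
      by (rule rank_le[OF p2])
    have "card (carry_monomials CARD('p) S) + k \<le> (\<Sum>l\<in>L. (k + l - 1) choose l)"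
      using card_carry_monomials[OF S(1) odd p2] S(2) L by simp
    \<comment> \<open>The \<open>k\<close> lifts complete the kernel dimension to \<open>?n\<close>,
      so \<open>r\<close> is at most the number of carry monomials.\<close>
    with S(3) ker rank have "r + int k \<le> int (\<Sum>l\<in>L. (k + l - 1) choose l)"
      by linarith
    then show "r \<le> (\<Sum>l\<in>L. int ((k + l - 1) choose l)) - int k"
      by simp
  qed
qed

end
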